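(* Let $d\ge 2$ be an integer, let $\mathbb{F}$ be a field, and let $\mathcal{L}$ be a set of lines in the projective space $\mathrm{PG}(d,\mathbb{F})$. If there is no projective subspace of co-dimension two (i.e. of projective dimension $d-2$) in $\mathrm{PG}(d,\mathbb{F})$ that meets every line of $\mathcal{L}$, then $\mathcal{L}$ is a generator set of lines with respect to hyperplanes.
   Context: A set $\mathcal{G}$ of points of $\mathrm{PG}(d,\mathbb{F})$ is a generator set with respect to hyperplanes if for every hyperplane $\Pi$ of $\mathrm{PG}(d,\mathbb{F})$ the set $\Pi\cap\mathcal{G}$ spans $\Pi$ (i.e. is not contained in any subspace of co-dimension two). A set $\mathcal{L}$ of lines is a generator set (with respect to hyperplanes) if the set $\bigcup\mathcal{L}$ of all points lying on lines of $\mathcal{L}$ is a generator set with respect to hyperplanes. *)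

theory Defs
  imports "HOL-Analysis.Cartesian_Space"
begin

text \<open>
  \<open>PG(d, F)\<close> is modelled on \<open>F\<^sup>d\<^sup>+\<^sup>1\<close>, i.e. on the type \<open>'f ^ 'n\<close> with \<open>CARD('n) = d + 1\<close>;
  points are the one-dimensional linear subspaces.
\<close>

definition pg_points :: "('f::field ^ 'n::finite) set set" where
  "pg_points = {P. vec.subspace P \<and> vec.dim P = 1}"

definition pg_flat :: "('f::field ^ 'n::finite) set \<Rightarrow> ('f ^ 'n) set set" where
  "pg_flat U = {P \<in> pg_points. P \<subseteq> U}"

definition pg_subspaces :: "('f::field ^ 'n::finite) set set set" where
  "pg_subspaces = {pg_flat U |U. vec.subspace U}"

text \<open>
  Projective dimension is one less than linear dimension; it is an integer, so that the
  empty subspace has dimension \<open>-1\<close>.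
\<close>

definition pg_subspaces_dim :: "int \<Rightarrow> ('f::field ^ 'n::finite) set set set" where
  "pg_subspaces_dim k = {pg_flat U |U. vec.subspace U \<and> int (vec.dim U) = k + 1}"

definition pg_subspaces_codim :: "int \<Rightarrow> ('f::field ^ 'n::finite) set set set" where
  "pg_subspaces_codim k = pg_subspaces_dim (int CARD('n) - 1 - k)"

definition pg_lines :: "('f::field ^ 'n::finite) set set set" where
  "pg_lines = pg_subspaces_dim 1"

definition pg_hyperplanes :: "('f::field ^ 'n::finite) set set set" where
  "pg_hyperplanes = pg_subspaces_codim 1"

definition pg_span :: "('f::field ^ 'n::finite) set set \<Rightarrow> ('f ^ 'n) set set" where
  "pg_span X = \<Inter> {S \<in> pg_subspaces. X \<subseteq> S}"

definition generator_set :: "('f::field ^ 'n::finite) set set \<Rightarrow> bool" where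
  "generator_set G \<longleftrightarrow> G \<subseteq> pg_points \<and> (\<forall>H \<in> pg_hyperplanes. pg_span (H \<inter> G) = H)"

definition generator_set_of_lines :: "('f::field ^ 'n::finite) set set set \<Rightarrow> bool" where
  "generator_set_of_lines L \<longleftrightarrow> L \<subseteq> pg_lines \<and> generator_set (\<Union> L)"

end

(* Suppose the points of H \<inter> \<Union>L lie in a subspace S not containing the hyperplane H. Then H \<inter> S has
   co-dimension at least two, so it extends to a subspace T of co-dimension exactly two. Every
   line of L meets H, and it does so in a point of S, hence of T. *)
theory Submission imports Defs begin

text \<open>As long as the dimension is below \<open>CARD('n)\<close>, some vector lies outside the
  subspace, and adjoining it raises the dimension by exactly one. The induction therefore starts at
  \<open>vec.dim U\<close> and climbs to \<open>k\<close>.\<close>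

lemma subspace_extend_dim:
  fixes U :: "('f::field ^ 'n::finite) set"
  assumes "vec.subspace U" "vec.dim U \<le> k" "k \<le> CARD('n)"
  obtains T where "vec.subspace T" "U \<subseteq> T" "vec.dim T = k"
proof -
  from assms(2,3) have "\<exists>T. vec.subspace T \<and> U \<subseteq> T \<and> vec.dim T = k"
  proof (induction k rule: dec_induct)
    case base
    show ?case using assms(1) by blast
  next
    case (step m)
    then obtain T where T: "vec.subspace T" "U \<subseteq> T" "vec.dim T = m" by auto
    have "T \<noteq> UNIV" using T(3) step.prems vec_dim_card by (metis not_less_eq_eq order_refl)
    then obtain x where x: "x \<notin> T" by blast
    have "x \<notin> vec.span T" using x T(1) by (metis vec.span_eq_iff)
    then have "vec.dim (vec.span (insert x T)) = Suc m" by (simp add: vec.dim_insert T(3))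
    moreover have "U \<subseteq> vec.span (insert x T)" using T(2) vec.span_superset by blast
    ultimately show ?case using vec.subspace_span by blast
  qed
  then show thesis using that by blast
qed

lemma span_singleton_in_pg_points: "x \<noteq> 0 \<Longrightarrow> vec.span {x} \<in> pg_points"
  by (simp add: pg_points_def)

lemma pg_flat_Int: "pg_flat U \<inter> pg_flat V = pg_flat (U \<inter> V)"
  by (auto simp: pg_flat_def)

lemma pg_flat_mono: "U \<subseteq> V \<Longrightarrow> pg_flat U \<subseteq> pg_flat V"
  by (auto simp: pg_flat_def)

text \<open>By Grassmann's formula the linear intersection has positive dimension, because the sum
  of the two subspaces cannot exceed the ambient space. Any nonzero vector in it spans a common
  point.\<close>

lemma pg_flat_Int_nonempty:
  fixes U V :: "('f::field ^ 'n::finite) set"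
  assumes "vec.subspace U" "vec.subspace V" "CARD('n) < vec.dim U + vec.dim V"
  shows "pg_flat U \<inter> pg_flat V \<noteq> {}"
proof -
  have "vec.dim {x + y |x y. x \<in> U \<and> y \<in> V} + vec.dim (U \<inter> V) = vec.dim U + vec.dim V"
    using vec.dim_sums_Int[OF assms(1,2)] .
  moreover have "vec.dim {x + y |x y. x \<in> U \<and> y \<in> V} \<le> CARD('n)"
    by (rule dim_subset_UNIV_cart_gen)
  ultimately have "vec.dim (U \<inter> V) \<noteq> 0" using assms(3) by linarith
  then obtain x where "x \<in> U \<inter> V" "x \<noteq> 0" by auto
  then have "vec.span {x} \<in> pg_flat (U \<inter> V)"
    using span_singleton_in_pg_points[of x] vec.span_minimal[of "{x}" "U \<inter> V"]
      vec.subspace_inter[OF assms(1,2)]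
    by (simp add: pg_flat_def)
  then show ?thesis by (auto simp: pg_flat_Int)
qed

text \<open>Reduces a spanning claim to a condition on one subspace \<open>S\<close> at a time, so
  that a failure hands over a concrete \<open>S\<close> to work with.\<close>

lemma pg_span_eqI:
  assumes "H \<in> pg_subspaces" "X \<subseteq> H"
    and "\<And>S. S \<in> pg_subspaces \<Longrightarrow> X \<subseteq> S \<Longrightarrow> H \<subseteq> S"
  shows "pg_span X = H"
  using assms by (auto simp: pg_span_def)

theorem mainTheorem1:
  fixes d :: nat
    and L :: "('f::field ^ 'n::finite) set set set"
  assumes "d \<ge> 2"
    and "CARD('n) = d + 1"
    and "L \<subseteq> pg_lines"
    and "\<not> (\<exists>S \<in> pg_subspaces_dim (int d - 2). \<forall>l \<in> L. S \<inter> l \<noteq> {})"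
  shows "generator_set_of_lines L"
proof -
  have line: "\<exists>A. l = pg_flat A \<and> vec.subspace A \<and> vec.dim A = 2" if "l \<in> L" for l
    using that assms(3) by (auto simp: pg_lines_def pg_subspaces_dim_def)
  have "pg_span (H \<inter> \<Union>L) = H" if H: "H \<in> pg_hyperplanes" for H
  proof -
    obtain W where W: "H = pg_flat W" "vec.subspace W" "vec.dim W = d"
      using H assms(2)
      by (auto simp: pg_hyperplanes_def pg_subspaces_codim_def pg_subspaces_dim_def)
    show ?thesis
    proof (rule pg_span_eqI)
      show "H \<in> pg_subspaces" using W by (auto simp: pg_subspaces_def)
      fix S assume "S \<in> pg_subspaces" and sub: "H \<inter> \<Union>L \<subseteq> S"
      then obtain U where U: "S = pg_flat U" "vec.subspace U" by (auto simp: pg_subspaces_def)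
      show "H \<subseteq> S"
      proof (rule ccontr)
        assume "\<not> H \<subseteq> S"
        \<comment> \<open>Equality would give \<open>W \<subseteq> U\<close> and hence
          \<open>H \<subseteq> S\<close>.\<close>
        then have "W \<inter> U \<subset> W" using pg_flat_mono U W by blast
        moreover have UW: "vec.subspace (W \<inter> U)" using U W vec.subspace_inter by blast
        ultimately have "vec.dim (W \<inter> U) < d"
          using vec.dim_psubset[of "W \<inter> U" W] W by (metis vec.span_eq_iff)
        \<comment> \<open>Linear dimension \<open>d - 1\<close> is projective dimension
          \<open>d - 2\<close>, that is, co-dimension two.\<close>
        then have "vec.dim (W \<inter> U) \<le> d - 1" "d - 1 \<le> CARD('n)" using assms(2) by simp_all
        then obtain T where T: "vec.subspace T" "W \<inter> U \<subseteq> T" "vec.dim T = d - 1"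
          by (rule subspace_extend_dim[OF UW])
        have "pg_flat T \<inter> l \<noteq> {}" if l: "l \<in> L" for l
        proof -
          obtain A where "l = pg_flat A" "vec.subspace A" "vec.dim A = 2" using line l by blast
          \<comment> \<open>The linear dimensions \<open>d\<close> of \<open>W\<close> and 2 of
            \<open>A\<close> add up to \<open>d + 2\<close>, one more than \<open>CARD('n)\<close>,
            so the line meets the hyperplane.\<close>
          then obtain P where P: "P \<in> H" "P \<in> l"
            using pg_flat_Int_nonempty[of W A] W assms(2) by auto
          then have "P \<in> H \<inter> S" using sub l by blast
          then have "P \<in> pg_flat T"
            using pg_flat_mono[OF T(2)] by (auto simp: U W pg_flat_Int)
          then show ?thesis using P by blast
        qed
        \<comment> \<open>As \<open>d\<close> is positive, the natural number \<open>d - 1\<close>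
          is not truncated and equals \<open>(int d - 2) + 1\<close> as an integer.\<close>
        moreover have "pg_flat T \<in> pg_subspaces_dim (int d - 2)"
          using T assms(1) by (auto simp: pg_subspaces_dim_def)
        ultimately show False using assms(4) by blast
      qed
    qed blast
  qed
  moreover have "\<Union>L \<subseteq> pg_points" using line by (fastforce simp: pg_flat_def)
  ultimately show ?thesis using assms(3) by (simp add: generator_set_of_lines_def generator_set_def)
qed

end
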